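(* Suppose $Z_{ij}\ge 0$ (componentwise) for every $(i,j)\in E$. Then the problem (NF-E-PF) is a relaxation of the problem (SOC-E-PF); that is, for every feasible solution $\big((S^g_i)_{i\in N},(W_i)_{i\in N},(W_{ij})_{(i,j)\in E},(S_{ij},S_{ji})_{(i,j)\in E}\big)$ of (SOC-E-PF), the tuple $\big((S^g_i)_{i\in N},(W_i)_{i\in N},(S_{ij},S_{ji})_{(i,j)\in E}\big)$ is a feasible solution of (NF-E-PF).
   Context: Conventions. $\mathbf i$ is the imaginary unit, $z^*$ is complex conjugation, $\Re,\Im$ are real and imaginary parts. An inequality between complex numbers, $z\le w$, means $\Re z\le \Re w$ and $\Im z\le\Im w$ (a real number is a complex number with zero imaginary part); a bound $z\in(z^l,z^u)$ on a variable means $z^l\le z\le z^u$ in this sense. Network data. $(N,E)$ is a finite graph with node set $N$; each edge is given one arbitrary orientation, so $E\subseteq N\times N$ has no loops and never contains both $(i,j)$ and $(j,i)$. Each $(i,j)\in E$ carries two flow variables: $S_{ij}$ (power leaving $i$, the "from" side) and $S_{ji}$ (power leaving $j$, the "to" side). Fixed parameters: for $i\in N$, $S^{gl}_i,S^{gu}_i,S^d_i,Y^s_i\in\mathbb C$ and reals $v^l_i,v^u_i\ge 0$; for $(i,j)\in E$, a nonzero line impedance $Z_{ij}\in\mathbb C$ with admittance $Y_{ij}=1/Z_{ij}$, line charging $b^c_{ij}\in\mathbb R$, a nonzero transformer parameter $T_{ij}\in\mathbb C$, an angle difference bound $\theta^\Delta_{ij}\in[0,\pi/2)$; and for each edge side,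 bounds $S^l_{ij},S^u_{ij},S^l_{ji},S^u_{ji}\in\mathbb C$ and thermal limits $s^u_{ij},s^u_{ji}\ge 0$. (SOC-E-PF). Variables: $S^g_i\in(S^{gl}_i,S^{gu}_i)$ complex and $W_i\in((v^l_i)^2,(v^u_i)^2)$ real for $i\in N$; $W_{ij}\in\mathbb C$ for $(i,j)\in E$; $S_{ij}\in(S^l_{ij},S^u_{ij})$ and $S_{ji}\in(S^l_{ji},S^u_{ji})$ complex for $(i,j)\in E$. Constraints: (1) for all $i\in N$: $S^g_i-S^d_i-(Y^s_i)^*W_i=\sum_{j:(i,j)\in E}S_{ij}+\sum_{j:(j,i)\in E}S_{ij}$ (sum of the flows leaving $i$ on all incident edges); (2) for all $(i,j)\in E$: $S_{ij}=\left(Y_{ij}^*-\mathbf i\frac{b^c_{ij}}2\right)\frac{W_i}{|T_{ij}|^2}-Y_{ij}^*\frac{W_{ij}}{T_{ij}^*}$; (3) for all $(i,j)\in E$: $S_{ji}=\left(Y_{ij}^*-\mathbf i\frac{b^c_{ij}}2\right)W_j-Y_{ij}^*\frac{W_{ij}^*}{T_{ij}}$; (4) for all $(i,j)\in E$: $|W_{ij}|^2\le W_iW_j$; (5) for all $(i,j)\in E$: $|S_{ij}|\le s^u_{ij}$ and $|S_{ji}|\le s^u_{ji}$; (6) for all $(i,j)\in E$: $\tan(-\theta^\Delta_{ij})\Re(W_{ij})\le\Im(W_{ij})\le\tan(\theta^\Delta_{ij})\Re(W_{ij})$. (NF-E-PF). Variables: $S^g_i\in(S^{gl}_i,S^{gu}_i)$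 complex and $W_i\in((v^l_i)^2,(v^u_i)^2)$ real for $i\in N$; $S_{ij}\in(S^l_{ij},S^u_{ij})$ and $S_{ji}\in(S^l_{ji},S^u_{ji})$ complex for $(i,j)\in E$. Constraints: (a) the nodal balance (1) above for all $i\in N$; (b) for all $(i,j)\in E$: $S_{ij}+S_{ji}\ge-\mathbf i\frac{b^c_{ij}}2\left(\frac{W_i}{|T_{ij}|^2}+W_j\right)$; (c) for all $(i,j)\in E$, with $A_{ij}:=Z_{ij}^*T_{ij}^*\left(\left(Y_{ij}^*-\mathbf i\frac{b^c_{ij}}2\right)\frac{W_i}{|T_{ij}|^2}-S_{ij}\right)$: $\tan(-\theta^\Delta_{ij})\Re(A_{ij})\le\Im(A_{ij})$ and $\tan(\theta^\Delta_{ij})\Re(A_{ij})\ge\Im(A_{ij})$. *)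

theory Defs
  imports "HOL-Analysis.Analysis"
begin

(* Componentwise order on the complex numbers. This is not the order of
   HOL-Library.Complex_Order, which demands equal imaginary parts. *)
definition cle :: "complex \<Rightarrow> complex \<Rightarrow> bool" (infix "\<preceq>" 50) where
  "z \<preceq> w \<longleftrightarrow> Re z \<le> Re w \<and> Im z \<le> Im w"

(* Edge parameters are indexed by ordered pairs of nodes. Line parameters (Z, bc, T, theta)
   are used only at (i, j) \<in> edges; flow bounds and thermal limits are used at (i, j) for the
   "from" side and at (j, i) for the "to" side. *)
record 'n network =
  nodes :: "'n set"
  edges :: "('n \<times> 'n) set"
  Sgl :: "'n \<Rightarrow> complex"
  Sgu :: "'n \<Rightarrow> complex"
  Sd :: "'n \<Rightarrow> complex"
  Ys :: "'n \<Rightarrow> complex"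
  vl :: "'n \<Rightarrow> real"
  vu :: "'n \<Rightarrow> real"
  Z :: "'n \<Rightarrow> 'n \<Rightarrow> complex"
  bc :: "'n \<Rightarrow> 'n \<Rightarrow> real"
  T :: "'n \<Rightarrow> 'n \<Rightarrow> complex"
  theta :: "'n \<Rightarrow> 'n \<Rightarrow> real"
  Sl :: "'n \<Rightarrow> 'n \<Rightarrow> complex"
  Su :: "'n \<Rightarrow> 'n \<Rightarrow> complex"
  su :: "'n \<Rightarrow> 'n \<Rightarrow> real"

definition Y :: "'n network \<Rightarrow> 'n \<Rightarrow> 'n \<Rightarrow> complex" where
  "Y G i j = 1 / Z G i j"

definition valid_network :: "'n network \<Rightarrow> bool" where
  "valid_network G \<longleftrightarrow>
     finite (nodes G) \<and>
     edges G \<subseteq> nodes G \<times> nodes G \<and>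
     (\<forall>i. (i, i) \<notin> edges G) \<and>
     (\<forall>i j. (i, j) \<in> edges G \<longrightarrow> (j, i) \<notin> edges G) \<and>
     (\<forall>i\<in>nodes G. 0 \<le> vl G i \<and> 0 \<le> vu G i) \<and>
     (\<forall>(i, j)\<in>edges G.
        Z G i j \<noteq> 0 \<and> T G i j \<noteq> 0 \<and>
        0 \<le> theta G i j \<and> theta G i j < pi / 2 \<and>
        0 \<le> su G i j \<and> 0 \<le> su G j i)"

(* Bounds on the variables common to both problems. Values of W and Sg outside the nodes, and of
   S at pairs that are not an edge side, are irrelevant. *)
definition variable_bounds ::
  "'n network \<Rightarrow> ('n \<Rightarrow> complex) \<Rightarrow> ('n \<Rightarrow> real) \<Rightarrow> ('n \<Rightarrow> 'n \<Rightarrow> complex) \<Rightarrow> bool" where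
  "variable_bounds G Sg W S \<longleftrightarrow>
     (\<forall>i\<in>nodes G. Sgl G i \<preceq> Sg i \<and> Sg i \<preceq> Sgu G i) \<and>
     (\<forall>i\<in>nodes G. (vl G i)\<^sup>2 \<le> W i \<and> W i \<le> (vu G i)\<^sup>2) \<and>
     (\<forall>(i, j)\<in>edges G.
        Sl G i j \<preceq> S i j \<and> S i j \<preceq> Su G i j \<and>
        Sl G j i \<preceq> S j i \<and> S j i \<preceq> Su G j i)"

definition nodal_balance ::
  "'n network \<Rightarrow> ('n \<Rightarrow> complex) \<Rightarrow> ('n \<Rightarrow> real) \<Rightarrow> ('n \<Rightarrow> 'n \<Rightarrow> complex) \<Rightarrow> bool" where
  "nodal_balance G Sg W S \<longleftrightarrow>
     (\<forall>i\<in>nodes G.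
        Sg i - Sd G i - cnj (Ys G i) * of_real (W i) =
          (\<Sum>j\<in>{j. (i, j) \<in> edges G}. S i j) + (\<Sum>j\<in>{j. (j, i) \<in> edges G}. S i j))"

(* V i j is the edge variable written W_ij in the literature; it is used only at edges. *)
definition soc_e_pf_feasible ::
  "'n network \<Rightarrow> ('n \<Rightarrow> complex) \<Rightarrow> ('n \<Rightarrow> real) \<Rightarrow> ('n \<Rightarrow> 'n \<Rightarrow> complex) \<Rightarrow>
     ('n \<Rightarrow> 'n \<Rightarrow> complex) \<Rightarrow> bool" where
  "soc_e_pf_feasible G Sg W V S \<longleftrightarrow>
     variable_bounds G Sg W S \<and>
     nodal_balance G Sg W S \<and>
     (\<forall>(i, j)\<in>edges G.
        S i j = (cnj (Y G i j) - \<i> * of_real (bc G i j / 2))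
                  * of_real (W i / (cmod (T G i j))\<^sup>2)
                - cnj (Y G i j) * (V i j / cnj (T G i j))) \<and>
     (\<forall>(i, j)\<in>edges G.
        S j i = (cnj (Y G i j) - \<i> * of_real (bc G i j / 2)) * of_real (W j)
                - cnj (Y G i j) * (cnj (V i j) / T G i j)) \<and>
     (\<forall>(i, j)\<in>edges G. (cmod (V i j))\<^sup>2 \<le> W i * W j) \<and>
     (\<forall>(i, j)\<in>edges G. cmod (S i j) \<le> su G i j \<and> cmod (S j i) \<le> su G j i) \<and>
     (\<forall>(i, j)\<in>edges G.
        tan (- theta G i j) * Re (V i j) \<le> Im (V i j) \<and>
        Im (V i j) \<le> tan (theta G i j) * Re (V i j))"

definition A ::
  "'n network \<Rightarrow> ('n \<Rightarrow> real) \<Rightarrow> ('n \<Rightarrow> 'n \<Rightarrow> complex) \<Rightarrow> 'n \<Rightarrow> 'n \<Rightarrow> complex" where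
  "A G W S i j =
     cnj (Z G i j) * cnj (T G i j) *
       ((cnj (Y G i j) - \<i> * of_real (bc G i j / 2)) * of_real (W i / (cmod (T G i j))\<^sup>2)
        - S i j)"

definition nf_e_pf_feasible ::
  "'n network \<Rightarrow> ('n \<Rightarrow> complex) \<Rightarrow> ('n \<Rightarrow> real) \<Rightarrow> ('n \<Rightarrow> 'n \<Rightarrow> complex) \<Rightarrow> bool" where
  "nf_e_pf_feasible G Sg W S \<longleftrightarrow>
     variable_bounds G Sg W S \<and>
     nodal_balance G Sg W S \<and>
     (\<forall>(i, j)\<in>edges G.
        - \<i> * of_real (bc G i j / 2) * of_real (W i / (cmod (T G i j))\<^sup>2 + W j)
          \<preceq> S i j + S j i) \<and>
     (\<forall>(i, j)\<in>edges G.
        tan (- theta G i j) * Re (A G W S i j) \<le> Im (A G W S i j) \<and>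
        tan (theta G i j) * Re (A G W S i j) \<ge> Im (A G W S i j))"

end

theory Submission
  imports Defs
begin

text \<open>
  The relaxation forgets the edge products \<open>V i j\<close>, so everything is to be read off from the flows.

  The angle constraints carry over because \<open>V i j\<close> is determined by the sending-side flow: solving the
  flow equation for it gives exactly \<open>A G W S i j\<close> (\<open>voltage_product_recovered_from_flow\<close>).

  For the loss inequality, put \<open>u = V i j / cnj (T i j)\<close> and \<open>w = W i / |T i j|\<^sup>2\<close>. The two flow equations
  contain \<open>u\<close> and its conjugate, so their sum is the line charging term plus
  \<open>(w + W j - 2 * Re u) * cnj (Y i j)\<close>. The real factor is nonnegative since the cone constraint says
  \<open>|u|\<^sup>2 \<le> w * W j\<close> and the geometric mean is at most the arithmetic mean; the complex factor is
  componentwise nonnegative since \<open>cnj (1 / Z) = Z / |Z|\<^sup>2\<close>. The losses on the line are therefore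
  componentwise nonnegative.
\<close>

text \<open>The geometric mean bounds \<open>Re u\<close> through \<open>|u|\<close>; for \<open>|u|\<^sup>2 = a * b\<close> this is the nonnegativity of
  \<open>|x - y|\<^sup>2\<close> when \<open>u = x * cnj y\<close>, \<open>a = |x|\<^sup>2\<close> and \<open>b = |y|\<^sup>2\<close>.\<close>

lemma twice_Re_le_sum_if_cmod_sq_le_mult:
  fixes a b :: real
  assumes "0 \<le> a" "0 \<le> b" "(cmod u)\<^sup>2 \<le> a * b"
  shows "2 * Re u \<le> a + b"
proof -
  have "(2 * cmod u)\<^sup>2 \<le> 4 * (a * b)"
    using assms(3) by (simp add: power_mult_distrib)
  also have "\<dots> \<le> (a + b)\<^sup>2"
    using zero_le_power2[of "a - b"] by (simp add: power2_eq_square algebra_simps)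
  finally have "2 * cmod u \<le> a + b"
    by (rule power2_le_imp_le) (use assms in simp)
  then show ?thesis
    using complex_Re_le_cmod[of u] by linarith
qed

lemma cnj_inverse_componentwise_nonneg:
  assumes "0 \<preceq> z"
  shows "0 \<preceq> cnj (1 / z)"
  using assms by (simp add: cle_def Re_divide Im_divide)

text \<open>The two terms in \<open>v\<close> are conjugate to each other once divided by \<open>cnj t\<close> and \<open>t\<close>, so that only a
  real part of \<open>v\<close> survives in the sum and \<open>y\<close> is multiplied by a real number.\<close>

lemma sum_of_opposite_flows:
  fixes y v t :: complex and b w w' :: real
  shows "((y - \<i> * of_real (b / 2)) * of_real w - y * (v / cnj t))
       + ((y - \<i> * of_real (b / 2)) * of_real w' - y * (cnj v / t))
       = - \<i> * of_real (b / 2) * of_real (w + w') + of_real (w + w' - 2 * Re (v / cnj t)) * y"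
proof -
  have "of_real (2 * Re (v / cnj t)) = v / cnj t + cnj v / t"
    using complex_add_cnj[of "v / cnj t"] by simp
  then show ?thesis
    by (simp only: of_real_diff of_real_add) (simp add: algebra_simps)
qed

lemma losses_componentwise_nonneg:
  fixes y v t :: complex and b w w' :: real
  assumes "t \<noteq> 0" "0 \<le> w" "0 \<le> w'" "(cmod v)\<^sup>2 \<le> w * w'" "0 \<preceq> y"
  shows "- \<i> * of_real (b / 2) * of_real (w / (cmod t)\<^sup>2 + w') \<preceq>
         ((y - \<i> * of_real (b / 2)) * of_real (w / (cmod t)\<^sup>2) - y * (v / cnj t))
       + ((y - \<i> * of_real (b / 2)) * of_real w' - y * (cnj v / t))"
proof -
  define r where "r = w / (cmod t)\<^sup>2 + w' - 2 * Re (v / cnj t)"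
  have "(cmod (v / cnj t))\<^sup>2 \<le> w / (cmod t)\<^sup>2 * w'"
    using assms by (simp add: norm_divide power_divide divide_right_mono)
  then have "0 \<le> r"
    using twice_Re_le_sum_if_cmod_sq_le_mult[of "w / (cmod t)\<^sup>2" w' "v / cnj t"] assms
    by (simp add: r_def)
  then have "0 \<preceq> of_real r * y"
    using assms(5) by (simp add: cle_def)
  then show ?thesis
    unfolding sum_of_opposite_flows r_def[symmetric] by (simp add: cle_def)
qed

lemma voltage_product_recovered_from_flow:
  assumes "Z G i j \<noteq> 0" "T G i j \<noteq> 0"
    and "S i j = (cnj (Y G i j) - \<i> * of_real (bc G i j / 2)) * of_real (W i / (cmod (T G i j))\<^sup>2)
               - cnj (Y G i j) * (v / cnj (T G i j))"
  shows "A G W S i j = v"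
  using assms(1,2) unfolding A_def assms(3) by (simp add: Y_def)

theorem corollary3p5:
  fixes G :: "'n network"
  assumes "valid_network G"
    and "\<forall>(i, j)\<in>edges G. 0 \<preceq> Z G i j"
  shows "\<forall>Sg W V S. soc_e_pf_feasible G Sg W V S \<longrightarrow> nf_e_pf_feasible G Sg W S"
proof (intro allI impI)
  fix Sg W V S
  assume feas: "soc_e_pf_feasible G Sg W V S"
  have bounds: "variable_bounds G Sg W S" and balance: "nodal_balance G Sg W S"
    using feas by (simp_all add: soc_e_pf_feasible_def)
  have W_nonneg: "0 \<le> W i" if "i \<in> nodes G" for i
  proof -
    have "(vl G i)\<^sup>2 \<le> W i"
      using bounds that by (simp add: variable_bounds_def)
    then show ?thesis
      using zero_le_power2[of "vl G i"] by linarith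
  qed
  have edge: "- \<i> * of_real (bc G i j / 2) * of_real (W i / (cmod (T G i j))\<^sup>2 + W j)
                \<preceq> S i j + S j i \<and>
              tan (- theta G i j) * Re (A G W S i j) \<le> Im (A G W S i j) \<and>
              tan (theta G i j) * Re (A G W S i j) \<ge> Im (A G W S i j)"
    if e: "(i, j) \<in> edges G" for i j
  proof
    have net: "Z G i j \<noteq> 0" "T G i j \<noteq> 0" "i \<in> nodes G" "j \<in> nodes G" "0 \<preceq> Z G i j"
      using assms e by (auto simp: valid_network_def)
    have Sij: "S i j = (cnj (Y G i j) - \<i> * of_real (bc G i j / 2))
                         * of_real (W i / (cmod (T G i j))\<^sup>2)
                       - cnj (Y G i j) * (V i j / cnj (T G i j))"
      using feas e unfolding soc_e_pf_feasible_def by blast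
    have Sji: "S j i = (cnj (Y G i j) - \<i> * of_real (bc G i j / 2)) * of_real (W j)
                       - cnj (Y G i j) * (cnj (V i j) / T G i j)"
      using feas e unfolding soc_e_pf_feasible_def by blast
    have cone: "(cmod (V i j))\<^sup>2 \<le> W i * W j"
      using feas e unfolding soc_e_pf_feasible_def by blast
    have angle: "tan (- theta G i j) * Re (V i j) \<le> Im (V i j) \<and>
                 Im (V i j) \<le> tan (theta G i j) * Re (V i j)"
      using feas e unfolding soc_e_pf_feasible_def by blast
    have "0 \<preceq> cnj (Y G i j)"
      unfolding Y_def using net(5) by (rule cnj_inverse_componentwise_nonneg)
    then show "- \<i> * of_real (bc G i j / 2) * of_real (W i / (cmod (T G i j))\<^sup>2 + W j)
                 \<preceq> S i j + S j i"
      unfolding Sij Sji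
      by (intro losses_componentwise_nonneg net(2) W_nonneg net(3,4) cone)
    have "A G W S i j = V i j"
      using net(1,2) Sij by (rule voltage_product_recovered_from_flow)
    then show "tan (- theta G i j) * Re (A G W S i j) \<le> Im (A G W S i j) \<and>
               tan (theta G i j) * Re (A G W S i j) \<ge> Im (A G W S i j)"
      using angle by simp
  qed
  show "nf_e_pf_feasible G Sg W S"
    unfolding nf_e_pf_feasible_def using bounds balance edge by blast
qed

end
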